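(* Let $k,\zeta\in\mathbb N$ with $\zeta\ge2$. For all $\theta\in\mathbb R^k$, let $h_\theta:\bigcup_{t=0}^\infty[\zeta]^t\to\mathrm{ri}\,\Delta^{\zeta-1}$. Assume that $\theta\mapsto h_\theta(\alpha)$ is continuously differentiable for all $\alpha\in\bigcup_{t=0}^\infty[\zeta]^t$. Then the next-token prediction capacity of $\{h_\theta\mid\theta\in\mathbb R^k\}$ is less than or equal to $k/(\zeta-1)$.
   Context: $[\zeta]=\{1,\ldots,\zeta\}$, and $[\zeta]^0$ consists of the empty sequence only. $\mathrm{ri}\,\Delta^{\zeta-1}=\{x\in\mathbb R^\zeta\mid x_i>0\ \forall i,\ \sum_i x_i=1\}$ is the relative interior of the unit simplex; continuous differentiability of $\theta\mapsto h_\theta(\alpha)$ is as a map into $\mathbb R^\zeta$. The next-token prediction capacity of $\{h_\theta\mid\theta\in\mathbb R^k\}$ is the largest $n\in\mathbb N$ such that for every list of distinct $\alpha^1,\ldots,\alpha^n\in\bigcup_{t=0}^\infty[\zeta]^t$ and every list $y_1,\ldots,y_n\in\mathrm{ri}\,\Delta^{\zeta-1}$ there exists $\theta\in\mathbb R^k$ such that $y_i=h_\theta(\alpha^i)$ for all $i\in[n]$ (it is $0$ if no $n$ has this property and $\infty$ if every $n$ does). *)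

theory Defs
  imports "HOL-Analysis.Analysis"
begin

definition continuously_differentiable ::
    "('a::real_normed_vector \<Rightarrow> 'b::real_normed_vector) \<Rightarrow> bool" where
  "continuously_differentiable f \<longleftrightarrow>
     (\<exists>f' :: 'a \<Rightarrow> 'a \<Rightarrow>\<^sub>L 'b.
        (\<forall>x. (f has_derivative blinfun_apply (f' x)) (at x)) \<and> continuous_on UNIV f')"

text \<open>
  The tokens are the elements of a finite type \<open>'z\<close>, with \<open>\<zeta> = CARD('z)\<close>; it indexes the
  coordinates of next-token distributions as well. Finite token sequences, including the empty
  one, are the elements of \<open>'z list\<close>.
\<close>

definition ri_simplex :: "(real ^ 'z::finite) set" where
  "ri_simplex = {x. (\<forall>i. 0 < x $ i) \<and> (\<Sum>i\<in>UNIV. x $ i) = 1}"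

definition interpolates ::
    "('z::finite list \<Rightarrow> real ^ 'z) set \<Rightarrow> nat \<Rightarrow> bool" where
  "interpolates H n \<longleftrightarrow>
     (\<forall>(\<alpha> :: 'z list list) (y :: (real ^ 'z) list).
        length \<alpha> = n \<and> distinct \<alpha> \<and> length y = n \<and> set y \<subseteq> ri_simplex \<longrightarrow>
        (\<exists>h\<in>H. \<forall>i<n. y ! i = h (\<alpha> ! i)))"

text \<open>
  In \<^typ>\<open>enat\<close>, the supremum of a set is its maximum if the set is finite and nonempty, \<open>0\<close> if it
  is empty, and \<open>\<infinity>\<close> if it is infinite. As \<open>interpolates H\<close> is downward closed, the last case
  occurs exactly if every \<open>n\<close> has the property.
\<close>

definition next_token_capacity :: "('z::finite list \<Rightarrow> real ^ 'z) set \<Rightarrow> enat" where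
  "next_token_capacity H = Sup {enat n | n. interpolates H n}"

end

theory Submission
  imports Defs
begin

text \<open>
  If \<open>n\<close> sequences can be interpolated and \<open>n (\<zeta> - 1) > k\<close>, then a differentiable map from
  \<open>\<real>\<^sup>k\<close> to a space of dimension \<open>n (\<zeta> - 1)\<close> (the values at the sequences, with one redundant
  coordinate dropped) has an image containing a nonempty open set; but this image is a null set. As \<open>n\<close> is
  not a type, both spaces are embedded into the matrices indexed by \<open>'k option \<times> 'z\<close>: the
  parameters become a coordinate subspace, and the surplus coordinates are mapped identically.
  The \<open>k + 1\<close> rows suffice because \<open>(k + 1) (\<zeta> - 1) > k\<close>.
\<close>

lemma continuously_differentiable_imp_differentiable:
  assumes "continuously_differentiable f"
  shows "f differentiable (at x)"
  using assms unfolding continuously_differentiable_def differentiable_def by blast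

lemma linear_vec_reindex: "linear (\<lambda>x :: real ^ 'm. (\<chi> a. x $ \<phi> a) :: real ^ 'n)"
  by (rule linearI) (simp_all add: vec_eq_iff)

lemma differentiable_vec_lambda:
  assumes "\<And>i. (\<lambda>x. f x i) differentiable (at a within S)"
  shows "(\<lambda>x. (\<chi> i. f x i) :: real ^ 'n) differentiable (at a within S)"
  using assms
  by (subst differentiable_componentwise_within) (auto simp: Basis_vec_def inner_axis)

lemma negligible_coordinate_hyperplane: "negligible {x :: real ^ 'n. x $ a = 0}"
proof -
  have "axis a 1 \<in> (Basis :: (real ^ 'n) set)"
    by (simp add: axis_in_Basis_iff)
  from negligible_standard_hyperplane[OF this, of 0] show ?thesis
    by (simp add: inner_axis)
qed

lemma interpolates_card_bound:
  fixes h :: "real ^ 'k \<Rightarrow> 'z::finite list \<Rightarrow> real ^ 'z"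
  assumes diff: "\<And>\<alpha> \<theta>. (\<lambda>\<theta>. h \<theta> \<alpha>) differentiable (at \<theta>)"
    and interp: "interpolates {h \<theta> | \<theta>. True} n"
  shows "n * (CARD('z) - 1) \<le> CARD('k)"
proof (rule ccontr)
  assume "\<not> ?thesis"
  then have large: "CARD('k) < n * (CARD('z) - 1)"
    by simp
  obtain e :: "'k option \<Rightarrow> nat" where e: "bij_betw e UNIV {0..<CARD('k option)}"
    using ex_bij_betw_finite_nat[of "UNIV :: 'k option set"] by auto
  \<comment> \<open>An arbitrary token: its coordinate is the redundant one, and the test sequences
    repeat it.\<close>
  obtain i0 :: 'z where True
    by simp
  \<comment> \<open>Row \<open>j\<close> stands for sequence number \<open>e j\<close>. If n > k +
    1, only the first k + 1 sequences get a row.\<close>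
  define J where "J = {j :: 'k option. e j < n}"
  define A where "A = J \<times> (UNIV - {i0})"
  have "e ` J = {..<min n (Suc CARD('k))}"
  proof -
    have "e ` J = e ` UNIV \<inter> {..<n}"
      unfolding J_def by auto
    also have "e ` UNIV = {0..<Suc CARD('k)}"
      using e by (simp add: bij_betw_def)
    finally show ?thesis
      by auto
  qed
  then have "card J = min n (Suc CARD('k))"
    using e unfolding bij_betw_def by (metis card_image card_lessThan inj_on_subset subset_UNIV)
  then have card_A: "card A = min n (Suc CARD('k)) * (CARD('z) - 1)"
    unfolding A_def by (simp add: card_cartesian_product)
  have "CARD('z) - 1 \<noteq> 0"
    using large by (cases "CARD('z) - 1 = 0") auto
  then have "Suc CARD('k) * 1 \<le> Suc CARD('k) * (CARD('z) - 1)"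
    by (intro mult_le_mono2) simp
  with large have "CARD('k) < card A"
    unfolding card_A by (auto simp: min_def)
  then obtain \<phi> :: "'k \<Rightarrow> 'k option \<times> 'z" where \<phi>: "inj \<phi>" "range \<phi> \<subseteq> A"
    using card_le_inj[of "UNIV :: 'k set" A] by auto
  have "card (range \<phi>) < card A"
    using \<open>CARD('k) < card A\<close> \<phi>(1) by (simp add: card_image)
  \<comment> \<open>A coordinate that \<open>f\<close> below ignores: entries in \<open>A\<close>
    read only the coordinates in \<open>range \<phi>\<close>, entries outside \<open>A\<close> only
    themselves. So \<open>f\<close> may be restricted to the null set where coordinate
    \<open>a\<close> vanishes.\<close>
  then obtain a where a: "a \<in> A" "a \<notin> range \<phi>"
    by (metis card_mono finite less_le_not_le subsetI)

  \<comment> \<open>Any distinct sequences would do; these differ in length.\<close>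
  define s :: "nat \<Rightarrow> 'z list" where "s m = replicate m i0" for m
  define f :: "real ^ ('k option \<times> 'z) \<Rightarrow> real ^ ('k option \<times> 'z)" where
    "f x = (\<chi> p. if p \<in> A then h (\<chi> c. x $ \<phi> c) (s (e (fst p))) $ snd p else x $ p)" for x
  have f_diff: "f differentiable (at x)" for x
    unfolding f_def
  proof (rule differentiable_vec_lambda)
    fix p :: "'k option \<times> 'z"
    have "(\<lambda>x :: real ^ ('k option \<times> 'z). h (\<chi> c. x $ \<phi> c) (s (e (fst p)))) differentiable (at x)"
      by (rule differentiable_compose[OF diff])
        (rule linear_imp_differentiable[OF linear_vec_reindex])
    then have "(\<lambda>x :: real ^ ('k option \<times> 'z). h (\<chi> c. x $ \<phi> c) (s (e (fst p))) $ snd p)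
        differentiable (at x)"
      by (rule differentiable_compose[OF
            linear_imp_differentiable[OF bounded_linear.linear[OF bounded_linear_vec_nth]]])
    moreover have "(\<lambda>x :: real ^ ('k option \<times> 'z). x $ p) differentiable (at x)"
      by (rule linear_imp_differentiable[OF bounded_linear.linear[OF bounded_linear_vec_nth]])
    ultimately show "(\<lambda>x. if p \<in> A then h (\<chi> c. x $ \<phi> c) (s (e (fst p))) $ snd p else x $ p)
        differentiable (at x)"
      by (cases "p \<in> A") simp_all
  qed
  have negl: "negligible (f ` {x. x $ a = 0})"
    by (rule negligible_differentiable_image_negligible[OF order_refl negligible_coordinate_hyperplane])
      (simp add: differentiable_at_imp_differentiable_on f_diff)

  \<comment> \<open>The strict inequalities make \<open>U\<close> open and leave a positive
    remainder in each row for the entry at \<open>i0\<close>.\<close>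
  define U :: "(real ^ ('k option \<times> 'z)) set" where
    "U = {w. (\<forall>p. 0 < w $ p) \<and> (\<forall>j. (\<Sum>i\<in>UNIV - {i0}. w $ (j, i)) < 1)}"
  have "open U"
    unfolding U_def
    by (intro open_Collect_conj)
      (auto simp: Collect_all_eq intro!: open_INT open_Collect_less continuous_intros)
  \<comment> \<open>Each row sum without \<open>i0\<close> is (\<zeta> - 1)/\<zeta> < 1.\<close>
  moreover have "(\<chi> p. 1 / real CARD('z)) \<in> U"
    unfolding U_def by (simp add: field_simps)
  moreover have "U \<subseteq> f ` {x. x $ a = 0}"
  proof
    fix w assume w: "w \<in> U"
    define row :: "'k option \<Rightarrow> real ^ 'z" where
      "row j = (\<chi> i. if i = i0 then 1 - (\<Sum>i\<in>UNIV - {i0}. w $ (j, i)) else w $ (j, i))" for j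
    have row_simplex: "row j \<in> ri_simplex" for j
      using w unfolding U_def row_def ri_simplex_def
      by (simp add: sum.remove[of UNIV i0])
    \<comment> \<open>For m > k the value \<open>inv e m\<close> is unspecified, which is harmless:
      every \<open>row j\<close> lies in the simplex.\<close>
    define y where "y = map (\<lambda>m. row (inv e m)) [0..<n]"
    have "distinct (map s [0..<n])"
      unfolding s_def by (auto simp: distinct_map inj_on_def)
    moreover have "set y \<subseteq> ri_simplex"
      using row_simplex by (auto simp: y_def)
    ultimately have "\<exists>g\<in>{h \<theta> | \<theta>. True}. \<forall>m<n. y ! m = g (map s [0..<n] ! m)"
      using interp[unfolded interpolates_def, rule_format, of "map s [0..<n]" y]
      by (auto simp: y_def)
    then obtain \<theta> where \<theta>: "\<And>m. m < n \<Longrightarrow> row (inv e m) = h \<theta> (s m)"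
      by (auto simp: y_def)
    \<comment> \<open>A preimage of \<open>w\<close> under \<open>f\<close>: it carries \<theta> on
      \<open>range \<phi>\<close>, copies \<open>w\<close> outside \<open>A\<close>, and is 0 on the
      rest of \<open>A\<close>, in particular at \<open>a\<close>.\<close>
    define x :: "real ^ ('k option \<times> 'z)" where
      "x = (\<chi> p. if p \<in> range \<phi> then \<theta> $ inv \<phi> p else if p \<in> A then 0 else w $ p)"
    have x\<phi>: "(\<chi> c. x $ \<phi> c) = \<theta>"
      by (simp add: x_def vec_eq_iff inv_f_f[OF \<phi>(1)])
    have "f x $ p = w $ p" for p
    proof (cases "p \<in> A")
      case True
      then obtain j i where p: "p = (j, i)" "e j < n" "i \<noteq> i0"
        unfolding A_def J_def by auto
      have "inv e (e j) = j"
        using e by (simp add: bij_betw_def)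
      then have "h \<theta> (s (e j)) = row j"
        using \<theta>[OF p(2)] by simp
      then show ?thesis
        using True p by (simp add: f_def x\<phi> row_def)
    next
      case False
      then show ?thesis
        using \<phi>(2) by (auto simp: f_def x_def)
    qed
    moreover have "x $ a = 0"
      using a by (simp add: x_def)
    ultimately show "w \<in> f ` {x. x $ a = 0}"
      by (intro image_eqI[of _ _ x]) (auto simp: vec_eq_iff)
  qed
  ultimately show False
    using negl open_not_negligible negligible_subset by blast
qed

theorem lemma9:
  fixes h :: "real ^ 'k \<Rightarrow> 'z::finite list \<Rightarrow> real ^ 'z"
  assumes "CARD('z) \<ge> 2"
    and "\<And>\<theta> \<alpha>. h \<theta> \<alpha> \<in> ri_simplex"
    and "\<And>\<alpha>. continuously_differentiable (\<lambda>\<theta>. h \<theta> \<alpha>)"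
  shows "ereal_of_enat (next_token_capacity {h \<theta> | \<theta>. True})
           \<le> ereal (real CARD('k) / (real CARD('z) - 1))"
proof -
  \<comment> \<open>Rounding down gives a natural number, so the supremum can be bounded within
    \<open>enat\<close> before passing to \<open>ereal\<close>.\<close>
  let ?q = "CARD('k) div (CARD('z) - 1)"
  have "n \<le> ?q" if "interpolates {h \<theta> | \<theta>. True} n" for n
    using interpolates_card_bound[OF continuously_differentiable_imp_differentiable[OF assms(3)] that]
      assms(1)
    by (simp add: less_eq_div_iff_mult_less_eq)
  then have "next_token_capacity {h \<theta> | \<theta>. True} \<le> enat ?q"
    unfolding next_token_capacity_def by (intro Sup_least) auto
  then have "ereal_of_enat (next_token_capacity {h \<theta> | \<theta>. True}) \<le> ereal_of_enat (enat ?q)"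
    by (simp only: ereal_of_enat_le_iff)
  also have "\<dots> \<le> ereal (real CARD('k) / real (CARD('z) - 1))"
    unfolding ereal_of_enat_simps ereal_less_eq by (rule of_nat_div_le_of_nat)
  also have "real (CARD('z) - 1) = real CARD('z) - 1"
    using assms(1) by (simp add: of_nat_diff)
  finally show ?thesis .
qed

end
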